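(* Let $p,q\ge 0$ be integers, let $z,a_1,\dots,a_p,b_1,\dots,b_q\in\mathbb{C}$, and put $$\lambda(x)=z(x+a_1)\cdots(x+a_p),\qquad \phi(x)=x(x+b_1)\cdots(x+b_q).$$ Let $L:\mathbb{C}[x]\to\mathbb{C}$ be a linear functional satisfying $$L[\lambda(x)\pi(x)]=L[\phi(x)\pi(x-1)]\quad\text{for all }\pi\in\mathbb{C}[x],$$ and let $\{P_n(x)\}_{n\ge 0}$ be the sequence of monic orthogonal polynomials with respect to $L$ (assumed to exist). Then for every $n\ge 0$ there are complex coefficients $A_k(n)$ ($-q-1\le k\le p$) and $B_k(n)$ ($-p\le k\le q+1$) such that $$\lambda(x)P_n(x+1)=\sum_{k=-q-1}^{p}A_k(n)P_{n+k}(x)$$ and $$\phi(x)P_n(x-1)=\sum_{k=-p}^{q+1}B_k(n)P_{n+k}(x).$$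
   Context: A sequence of monic polynomials $P_n\in\mathbb{C}[x]$ with $\deg P_n=n$, $n=0,1,\dots$, is orthogonal with respect to a linear functional $L:\mathbb{C}[x]\to\mathbb{C}$ if $L[P_nP_m]=h_n\delta_{n,m}$ for all $n,m\ge 0$, with $h_n\neq 0$. Convention: $P_m(x)=0$ for $m<0$. *)

theory Defs
  imports "HOL-Computational_Algebra.Polynomial"
begin

abbreviation linear_functional :: "(complex poly \<Rightarrow> complex) \<Rightarrow> bool" where
  "linear_functional L \<equiv> Vector_Spaces.linear smult (*) L"

definition monic_ops :: "(complex poly \<Rightarrow> complex) \<Rightarrow> (nat \<Rightarrow> complex poly) \<Rightarrow> bool" where
  "monic_ops L P \<longleftrightarrow>
     (\<forall>n. degree (P n) = n \<and> lead_coeff (P n) = 1) \<and>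
     (\<exists>h :: nat \<Rightarrow> complex. (\<forall>n. h n \<noteq> 0) \<and>
        (\<forall>n m. L (P n * P m) = h n * (if n = m then 1 else 0)))"

definition ext_seq :: "(nat \<Rightarrow> complex poly) \<Rightarrow> int \<Rightarrow> complex poly" where
  "ext_seq P m = (if m < 0 then 0 else P (nat m))"

definition lambda_poly :: "complex \<Rightarrow> nat \<Rightarrow> (nat \<Rightarrow> complex) \<Rightarrow> complex poly" where
  "lambda_poly z p a = smult z (\<Prod>i = 1..p. [:a i, 1:])"

definition phi_poly :: "nat \<Rightarrow> (nat \<Rightarrow> complex) \<Rightarrow> complex poly" where
  "phi_poly q b = [:0, 1:] * (\<Prod>i = 1..q. [:b i, 1:])"

text \<open>\<open>shift_poly c f\<close> is the polynomial \<open>f(x + c)\<close>.\<close>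

definition shift_poly :: "complex \<Rightarrow> complex poly \<Rightarrow> complex poly" where
  "shift_poly c f = pcompose f [:c, 1:]"

end

(* L[f(x) P_m(x)] determines the coefficient of P_m in the expansion of f. The functional equation,
   applied to a product with one factor shifted, moves the shift from P_n to P_m; then
   orthogonality of P_n to all polynomials of smaller degree kills every coefficient with m
   outside the stated range, while the degree of f bounds m from above. *)
theory Submission
  imports Defs
begin

lemma shift_poly_mult: "shift_poly c (f * g) = shift_poly c f * shift_poly c g"
  by (simp add: shift_poly_def pcompose_mult)

lemma shift_poly_shift_poly: "shift_poly c (shift_poly d f) = shift_poly (c + d) f"
  by (simp add: shift_poly_def pcompose_assoc [symmetric] pcompose_pCons add.commute)

lemma shift_poly_0: "shift_poly 0 f = f"
  by (simp add: shift_poly_def)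

lemma degree_shift_poly: "degree (shift_poly c f) = degree f"
  by (simp add: shift_poly_def degree_pcompose)

lemma degree_prod_monic_linear_le: "degree (\<Prod>i = 1..n. [:c i, 1:]) \<le> n"
  for c :: "nat \<Rightarrow> 'a::comm_ring_1"
  using degree_prod_sum_le [of "{1..n}" "\<lambda>i. [:c i, 1:]"] by simp

text \<open>Only an upper bound, because \<open>z\<close> may be 0.\<close>

lemma degree_lambda_poly_le: "degree (lambda_poly z p a) \<le> p"
  unfolding lambda_poly_def
  using degree_smult_le degree_prod_monic_linear_le by (rule order_trans)

lemma degree_phi_poly_le: "degree (phi_poly q b) \<le> q + 1"
  unfolding phi_poly_def
  by (rule order_trans [OF degree_mult_le])
    (use degree_prod_monic_linear_le [of b q] in simp)

text \<open>Since \<open>P N\<close> is monic of degree \<open>N\<close>, subtracting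
  \<open>coeff f N\<close> times \<open>P N\<close> cancels the coefficient at \<open>N\<close> and
  creates none above it; induct on \<open>N\<close>. Vanishing coefficients instead of a degree
  bound let \<open>N = 0\<close> mean \<open>f = 0\<close>, the base case.\<close>

lemma monic_basis_expansion:
  fixes P :: "nat \<Rightarrow> 'a::comm_ring_1 poly"
  assumes "\<And>n. degree (P n) = n" "\<And>n. lead_coeff (P n) = 1"
    and "\<And>i. i \<ge> N \<Longrightarrow> coeff f i = 0"
  shows "\<exists>c. f = (\<Sum>m<N. smult (c m) (P m))"
  using assms(3)
proof (induction N arbitrary: f)
  case 0
  then show ?case by (auto simp: poly_eq_iff)
next
  case (Suc N)
  let ?g = "f - smult (coeff f N) (P N)"
  have "coeff ?g i = 0" if "i \<ge> N" for i
  proof (cases "i = N")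
    case True
    then show ?thesis using assms(1,2) [of N] by simp
  next
    case False
    with that have "Suc N \<le> i" by simp
    then show ?thesis using Suc.prems assms(1) [of N] by (simp add: coeff_eq_0)
  qed
  from Suc.IH [OF this] obtain c where c: "?g = (\<Sum>m<N. smult (c m) (P m))" by blast
  have "f = (\<Sum>m<Suc N. smult ((c(N := coeff f N)) m) (P m))"
    using c by (simp add: algebra_simps)
  then show ?case by blast
qed

lemma monic_ops_expansion:
  assumes "monic_ops L P" and "degree f < N"
  shows "\<exists>c. f = (\<Sum>m<N. smult (c m) (P m))"
proof (rule monic_basis_expansion)
  show "degree (P n) = n" "lead_coeff (P n) = 1" for n
    using assms(1) unfolding monic_ops_def by blast+
  show "coeff f i = 0" if "i \<ge> N" for i
    using assms(2) that by (simp add: coeff_eq_0)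
qed

lemma monic_ops_orthogonal:
  assumes "monic_ops L P" and "n \<noteq> m"
  shows "L (P n * P m) = 0"
  using assms by (auto simp: monic_ops_def)

text \<open>Expand \<open>f\<close> in the \<open>P m\<close> with \<open>m < n\<close>; each term
  is orthogonal to \<open>P n\<close>.\<close>

lemma monic_ops_orthogonal_lower_degree:
  assumes L: "linear_functional L" and P: "monic_ops L P" and "degree f < n"
  shows "L (P n * f) = 0"
proof -
  interpret L: Vector_Spaces.linear smult "(*)" L by (fact L)
  obtain c where "f = (\<Sum>m<n. smult (c m) (P m))"
    using monic_ops_expansion [OF P \<open>degree f < n\<close>] by blast
  then show ?thesis
    by (simp add: sum_distrib_left L.sum L.scale monic_ops_orthogonal [OF P])
qed

text \<open>Serves both expansions of the theorem: \<open>r\<close> bounds the band above through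
  the degree, \<open>s\<close> bounds it below through orthogonality. Writing
  \<open>m + s < n\<close> avoids truncated subtraction on naturals.\<close>

lemma monic_ops_banded_expansion:
  assumes L: "linear_functional L" and P: "monic_ops L P"
    and deg: "degree f \<le> n + r"
    and orth: "\<And>m. m + s < n \<Longrightarrow> L (f * P m) = 0"
  shows "\<exists>C. f = (\<Sum>k = - int s..int r. smult (C k) (ext_seq P (int n + k)))"
proof -
  interpret L: Vector_Spaces.linear smult "(*)" L by (fact L)
  obtain c where c: "f = (\<Sum>m<Suc (n + r). smult (c m) (P m))"
    using monic_ops_expansion [OF P, of f "Suc (n + r)"] deg by auto
  obtain h where h: "\<And>n. h n \<noteq> 0" "\<And>n m. L (P n * P m) = h n * (if n = m then 1 else 0)"
    using P by (auto simp: monic_ops_def)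
  have c0: "c m = 0" if "m + s < n" for m
  proof -
    have "L (f * P m) = (\<Sum>i<Suc (n + r). c i * (h i * (if i = m then 1 else 0)))"
      unfolding c by (simp only: sum_distrib_right mult_smult_left L.sum L.scale h)
    also have "\<dots> = (\<Sum>i<Suc (n + r). if i = m then c i * h i else 0)"
      by (intro sum.cong) auto
    \<comment> \<open>The assumption \<open>m + s < n\<close> puts \<open>m\<close> inside the
      summation range, so the term \<open>i = m\<close> does occur.\<close>
    also have "\<dots> = c m * h m" using that by (simp add: sum.delta del: sum.lessThan_Suc)
    finally show ?thesis using orth [OF that] h(1) by simp
  qed
  \<comment> \<open>For \<open>int n + k < 0\<close> this is the arbitrary value \<open>c 0\<close>,
    harmless because \<open>ext_seq P\<close> is 0 there.\<close>
  let ?C = "\<lambda>k. c (nat (int n + k))"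
  have "f = (\<Sum>k = - int s..int r. smult (?C k) (ext_seq P (int n + k)))"
    unfolding c
    \<comment> \<open>Substitute \<open>m = n + k\<close>. The ranges match only after dropping zero
      terms: indices \<open>m\<close> below \<open>n - s\<close>, where \<open>c m = 0\<close>, and
      indices \<open>k\<close> below \<open>- n\<close>, where \<open>ext_seq P\<close>
      vanishes.\<close>
    by (rule sum.reindex_bij_witness_not_neutral
        [of "{m. m + s < n} \<inter> {..<Suc (n + r)}" "{k. int n + k < 0} \<inter> {- int s..int r}"
          _ "\<lambda>k. nat (int n + k)" "\<lambda>m. int m - int n"])
      (auto simp: ext_seq_def c0)
  then show ?thesis by (rule exI [where x = ?C])
qed

theorem proposition1:
  fixes p q :: nat and z :: complex and a b :: "nat \<Rightarrow> complex"
    and L :: "complex poly \<Rightarrow> complex" and P :: "nat \<Rightarrow> complex poly"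
  assumes "linear_functional L"
    and "\<And>f :: complex poly.
           L (lambda_poly z p a * f) = L (phi_poly q b * shift_poly (- 1) f)"
    and "monic_ops L P"
  shows "\<forall>n :: nat. \<exists>A B :: int \<Rightarrow> complex.
           lambda_poly z p a * shift_poly 1 (P n)
             = (\<Sum>k = - int q - 1..int p. smult (A k) (ext_seq P (int n + k))) \<and>
           phi_poly q b * shift_poly (- 1) (P n)
             = (\<Sum>k = - int p..int q + 1. smult (B k) (ext_seq P (int n + k)))"
proof
  fix n
  let ?l = "lambda_poly z p a" and ?f = "phi_poly q b"
  have degP: "degree (P m) = m" for m using assms(3) by (simp add: monic_ops_def)
  have "\<exists>A. ?l * shift_poly 1 (P n)
      = (\<Sum>k = - int (q + 1)..int p. smult (A k) (ext_seq P (int n + k)))"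
  proof (rule monic_ops_banded_expansion [OF assms(1,3)])
    show "degree (?l * shift_poly 1 (P n)) \<le> n + p"
      using degree_mult_le [of ?l "shift_poly 1 (P n)"] degree_lambda_poly_le [of z p a]
      by (simp add: degree_shift_poly degP)
    fix m assume m: "m + (q + 1) < n"
    \<comment> \<open>The test polynomial is P_n(x+1) P_m(x): its shift by -1 is P_n(x) P_m(x-1),
      which frees \<open>P n\<close>. The cofactor has degree at most \<open>m + q + 1\<close>,
      hence below \<open>n\<close>.\<close>
    have "L (?l * shift_poly 1 (P n) * P m) = L (P n * (?f * shift_poly (- 1) (P m)))"
      using assms(2) [of "shift_poly 1 (P n) * P m"]
      by (simp add: shift_poly_mult shift_poly_shift_poly shift_poly_0 mult_ac)
    also have "\<dots> = 0"
      by (rule monic_ops_orthogonal_lower_degree [OF assms(1,3)])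
        (use degree_mult_le [of ?f "shift_poly (- 1) (P m)"] degree_phi_poly_le [of q b] m
          in \<open>simp add: degree_shift_poly degP\<close>)
    finally show "L (?l * shift_poly 1 (P n) * P m) = 0" .
  qed
  moreover have "\<exists>B. ?f * shift_poly (- 1) (P n)
      = (\<Sum>k = - int p..int (q + 1). smult (B k) (ext_seq P (int n + k)))"
  proof (rule monic_ops_banded_expansion [OF assms(1,3)])
    show "degree (?f * shift_poly (- 1) (P n)) \<le> n + (q + 1)"
      using degree_mult_le [of ?f "shift_poly (- 1) (P n)"] degree_phi_poly_le [of q b]
      by (simp add: degree_shift_poly degP)
    fix m assume m: "m + p < n"
    \<comment> \<open>Here the functional equation is read from right to left, with test polynomial
      P_n(x) P_m(x+1). The cofactor of \<open>P n\<close> now has degree at most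
      \<open>m + p < n\<close>.\<close>
    have "L (?f * shift_poly (- 1) (P n) * P m) = L (P n * (?l * shift_poly 1 (P m)))"
      using assms(2) [of "P n * shift_poly 1 (P m)"]
      by (simp add: shift_poly_mult shift_poly_shift_poly shift_poly_0 mult_ac)
    also have "\<dots> = 0"
      by (rule monic_ops_orthogonal_lower_degree [OF assms(1,3)])
        (use degree_mult_le [of ?l "shift_poly 1 (P m)"] degree_lambda_poly_le [of z p a] m
          in \<open>simp add: degree_shift_poly degP\<close>)
    finally show "L (?f * shift_poly (- 1) (P n) * P m) = 0" .
  qed
  \<comment> \<open>The band lemma takes natural bounds, here \<open>q + 1\<close>; these equations
    restore the integer limits of the theorem.\<close>
  moreover have "- int (q + 1) = - int q - 1" "int (q + 1) = int q + 1" by simp_all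
  ultimately show "\<exists>A B. ?l * shift_poly 1 (P n)
      = (\<Sum>k = - int q - 1..int p. smult (A k) (ext_seq P (int n + k))) \<and>
    ?f * shift_poly (- 1) (P n)
      = (\<Sum>k = - int p..int q + 1. smult (B k) (ext_seq P (int n + k)))"
    by (simp only:) blast
qed

end
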